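(* Let $F$ be a flat subset of edges of a strongly connected digraph $D^*=(V,A^* )$ with $|V|\ge 2$ and let $w:V\to\{0,1,2,\dots\}$ be an integer-valued weight function. The maximum of $\sum_{v\in S}w(v)$ over all $F$-stable sets $S$ of $D^*$ is equal to the minimum total $F$-value of a system of di-circuits of $D^*$ covering $w$. Moreover, for a given subset $U\subseteq V$, the maximum cardinality of an $F$-stable subset of $U$ is equal to the minimum total $F$-value of di-circuits of $D^*$ covering $U$.
   Context: Digraphs are finite and loopless; parallel and oppositely directed edges are allowed. A di-circuit is a directed circuit (two oppositely directed edges between the same two nodes form a di-circuit); $K$ also denotes the edge-set of a di-circuit and $V(K)$ its node-set. An edge is cyclic if it belongs to a di-circuit. A subset $F$ of edges is flat if every cyclic edge belongs to a di-circuit containing exactly one element of $F$ ($F$ need not meet every di-circuit). A directed cut (dicut) of a digraph is the set of edges entering a subset $Z$ of nodes, provided no edge leaves $Z$. A sink node is a node with no leaving edge; a sink set is a set of nodes each of which is a sink. A set of nodes is sink-stable in a digraph if there are pairwise edge-disjoint dicuts of the digraph such that, after reversing the orientation of all edges of these dicuts, the set becomes a sink set. A set of nodes is $F$-stable in $D^*$ if it is sink-stable in the digraph arising from $D^*$ by reversing the edges in $F$. The $F$-value of a di-circuit $K$ is $|F\cap K|$. A system of di-circuits is a finite collection in which members may be repeated (non-negative integer multiplicities); its total $F$-value is the sum of the $F$-values of its members counted with multiplicity. It covers $w$ if each node $v\in V$ belongs to at least $w(v)$ of its members (counted with multiplicity), and it covers $U$ if each node of $U$ belongs to at least one member. *)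

theory Defs
  imports "Graph_Theory.Digraph_Component" "HOL-Library.Multiset" "HOL-Library.Disjoint_Sets"
begin

(* Finite loopless digraphs; parallel and oppositely directed arcs are allowed, hence
   nomulti_digraph is not included. *)
locale fin_loopfree_digraph = fin_digraph + loopfree_digraph

(* A di-circuit is represented by its arc set, so that rotations of the same closed walk are
   identified. The library's cycle admits length 1, but such a cycle is a loop. *)
definition dicircuits :: "('a, 'b) pre_digraph \<Rightarrow> 'b set set" where
  "dicircuits D = {set p | p. pre_digraph.cycle D p}"

definition dicircuit_verts :: "('a, 'b) pre_digraph \<Rightarrow> 'b set \<Rightarrow> 'a set" where
  "dicircuit_verts D K = tail D ` K \<union> head D ` K"

definition cyclic_arc :: "('a, 'b) pre_digraph \<Rightarrow> 'b \<Rightarrow> bool" where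
  "cyclic_arc D e \<longleftrightarrow> (\<exists>K \<in> dicircuits D. e \<in> K)"

definition flat :: "('a, 'b) pre_digraph \<Rightarrow> 'b set \<Rightarrow> bool" where
  "flat D F \<longleftrightarrow> F \<subseteq> arcs D \<and>
     (\<forall>e \<in> arcs D. cyclic_arc D e \<longrightarrow> (\<exists>K \<in> dicircuits D. e \<in> K \<and> card (F \<inter> K) = 1))"

definition entering :: "('a, 'b) pre_digraph \<Rightarrow> 'a set \<Rightarrow> 'b set" where
  "entering D Z = {e \<in> arcs D. tail D e \<notin> Z \<and> head D e \<in> Z}"

definition leaving :: "('a, 'b) pre_digraph \<Rightarrow> 'a set \<Rightarrow> 'b set" where
  "leaving D Z = {e \<in> arcs D. tail D e \<in> Z \<and> head D e \<notin> Z}"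

definition dicuts :: "('a, 'b) pre_digraph \<Rightarrow> 'b set set" where
  "dicuts D = {entering D Z | Z. Z \<subseteq> verts D \<and> leaving D Z = {}}"

definition reorient :: "('a, 'b) pre_digraph \<Rightarrow> 'b set \<Rightarrow> ('a, 'b) pre_digraph" where
  "reorient D B = D\<lparr> tail := (\<lambda>e. if e \<in> B then head D e else tail D e),
                     head := (\<lambda>e. if e \<in> B then tail D e else head D e) \<rparr>"

definition sink_set :: "('a, 'b) pre_digraph \<Rightarrow> 'a set \<Rightarrow> bool" where
  "sink_set D S \<longleftrightarrow> S \<subseteq> verts D \<and> (\<forall>v \<in> S. out_arcs D v = {})"

definition sink_stable :: "('a, 'b) pre_digraph \<Rightarrow> 'a set \<Rightarrow> bool" where
  "sink_stable D S \<longleftrightarrow>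
     (\<exists>\<C>. \<C> \<subseteq> dicuts D \<and> disjoint \<C> \<and> sink_set (reorient D (\<Union>\<C>)) S)"

definition F_stable :: "('a, 'b) pre_digraph \<Rightarrow> 'b set \<Rightarrow> 'a set \<Rightarrow> bool" where
  "F_stable D F S \<longleftrightarrow> sink_stable (reorient D F) S"

definition dicircuit_system :: "('a, 'b) pre_digraph \<Rightarrow> 'b set multiset \<Rightarrow> bool" where
  "dicircuit_system D M \<longleftrightarrow> set_mset M \<subseteq> dicircuits D"

definition F_value :: "'b set \<Rightarrow> 'b set \<Rightarrow> nat" where
  "F_value F K = card (F \<inter> K)"

definition total_F_value :: "'b set \<Rightarrow> 'b set multiset \<Rightarrow> nat" where
  "total_F_value F M = (\<Sum>K\<in>#M. F_value F K)"

definition covers_weight :: "('a, 'b) pre_digraph \<Rightarrow> 'b set multiset \<Rightarrow> ('a \<Rightarrow> nat) \<Rightarrow> bool" where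
  "covers_weight D M w \<longleftrightarrow>
     (\<forall>v \<in> verts D. w v \<le> size {#K \<in># M. v \<in> dicircuit_verts D K#})"

definition covers_set :: "('a, 'b) pre_digraph \<Rightarrow> 'b set multiset \<Rightarrow> 'a set \<Rightarrow> bool" where
  "covers_set D M U \<longleftrightarrow> (\<forall>v \<in> U. \<exists>K \<in># M. v \<in> dicircuit_verts D K)"

(* Max and Min are unspecified on infinite or empty sets; these predicates assert that the
   extremum is attained. *)
definition is_maximum :: "nat set \<Rightarrow> nat \<Rightarrow> bool" where
  "is_maximum X m \<longleftrightarrow> m \<in> X \<and> (\<forall>x \<in> X. x \<le> m)"

definition is_minimum :: "nat set \<Rightarrow> nat \<Rightarrow> bool" where
  "is_minimum X m \<longleftrightarrow> m \<in> X \<and> (\<forall>x \<in> X. m \<le> x)"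

end

theory Submission
  imports Defs
begin

text \<open>The theorem is linear programming duality for a minimum cost circulation, where flatness is what
  turns the optimal dual solution into a stable set.

  Reversing pairwise disjoint dicuts amounts to choosing an integer potential \<open>\<pi>\<close> that increases
  by 0 or 1 along every arc, the reversed arcs being those of increase 1. Hence a node set \<open>S\<close>
  is \<open>F\<close>-stable iff some \<open>\<pi>\<close> satisfies \<open>[u \<in> S] \<le> s(e) \<le> 1 - [v \<in> S]\<close> for every arc \<open>e\<close> from \<open>u\<close> to
  \<open>v\<close>, where \<open>s(e) = [e \<in> F] + \<pi>(v) - \<pi>(u)\<close> (\<open>F_stable_iff_potential\<close>). Along a di-circuit \<open>K\<close> the
  potential differences cancel, so the lower bounds add up to \<open>|S \<inter> V(K)| \<le> |F \<inter> K|\<close>, and summing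
  this over a covering system shows that the maximum is at most the minimum
  (\<open>weight_F_stable_le_cover\<close>).

  Conversely, a cheapest covering system is a cheapest integer circulation, with cost 1 on the arcs
  of \<open>F\<close> and 0 elsewhere, that passes through each node \<open>v\<close> at least \<open>w(v)\<close> times, because
  circulations decompose into di-circuits. Since a cheapest circulation has no residual di-circuit of
  negative cost, shortest paths in the residual digraph give an integral dual optimum \<open>y \<ge> 0\<close>, \<open>\<pi>\<close>
  with \<open>y(u) \<le> s(e)\<close> and objective value \<open>\<Sum>v. w(v) y(v)\<close> equal to the cost
  (\<open>node_cover_duality\<close>). By flatness and strong connectivity every arc \<open>e\<close> lies on a di-circuit of
  \<open>F\<close>-value 1, along which the non-negative numbers \<open>s\<close> add up to 1; this forces
  \<open>s(e) \<le> 1 - y(v)\<close> (\<open>flat_slack_bound\<close>). So \<open>y\<close> is the indicator function of an \<open>F\<close>-stable set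
  whose weight is the cost of the covering system. The statement on a node set \<open>U\<close> is the case where
  \<open>w\<close> is the indicator function of \<open>U\<close>, as subsets of \<open>F\<close>-stable sets are \<open>F\<close>-stable.\<close>

section \<open>Di-circuits and circulations\<close>

lemma (in wf_digraph) awalk_telescope:
  fixes f :: "'a \<Rightarrow> int"
  assumes "awalk u p v"
  shows "(\<Sum>e\<leftarrow>p. f (head G e) - f (tail G e)) = f v - f u"
  using assms by (induction p arbitrary: u) (auto simp: awalk_simps)

text \<open>A closed walk whose heads are distinct also has distinct tails, since the list of tails is
  a rotation of the list of heads.\<close>

lemma (in wf_digraph) dicircuitE:
  assumes "K \<in> dicircuits G"
  obtains u p where "awalk u p u" "distinct p" "p \<noteq> []" "K = set p"
    "distinct (map (tail G) p)" "tail G ` K = head G ` K"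
proof -
  obtain u p where p: "awalk u p u" "distinct (tl (awalk_verts u p))" "distinct p" "p \<noteq> []" "K = set p"
    using assms by (auto simp: dicircuits_def cycle_conv)
  have cas: "cas u p u" using p by auto
  have hd: "distinct (map (head G) p)"
    using p awalk_verts_conv'[OF cas] by simp
  have eq: "tail G (hd p) # map (head G) p = map (tail G) p @ [head G (last p)]"
    using awalk_verts_conv'[OF cas] awalk_verts_conv[of u p] p(4) by simp
  have ends: "tail G (hd p) = u" "head G (last p) = u"
    using p cas awalk_verts_conv[of u p] by (auto simp: cas_simp)
  have "mset (tail G (hd p) # map (head G) p) = mset (map (tail G) p @ [head G (last p)])"
    using eq by (rule arg_cong)
  then have m: "mset (map (head G) p) = mset (map (tail G) p)"
    using ends by simp
  show thesis
    using that[OF p(1,3,4,5)] hd mset_eq_imp_distinct_iff[OF m] mset_eq_setD[OF m] p(5) by auto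
qed

lemma (in wf_digraph) dicircuit_facts:
  assumes "K \<in> dicircuits G"
  shows dicircuit_subset_arcs: "K \<subseteq> arcs G"
    and dicircuit_finite: "finite K"
    and dicircuit_inj_on_tail: "inj_on (tail G) K"
    and dicircuit_verts_eq_tails: "dicircuit_verts G K = tail G ` K"
    and dicircuit_nonempty: "K \<noteq> {}"
  by (rule dicircuitE[OF assms], auto simp: distinct_map dicircuit_verts_def)+

lemma (in wf_digraph) sum_dicircuit_boundary:
  fixes f :: "'a \<Rightarrow> int"
  assumes "K \<in> dicircuits G"
  shows "(\<Sum>e\<in>K. f (head G e) - f (tail G e)) = 0"
proof (rule dicircuitE[OF assms])
  fix u p assume "awalk u p u" "distinct p" "K = set p"
  then show ?thesis using awalk_telescope[of u p u f] by (simp add: sum_list_distinct_conv_sum_set)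
qed

text \<open>Conservation of flow is tested against all functions on the nodes; the indicator functions of
  single nodes give Kirchhoff's law. In this form no node has to be singled out: potentials can be
  inserted as they are, and sums over all arcs need not be regrouped at the nodes.\<close>

definition circulation :: "('a, 'b) pre_digraph \<Rightarrow> ('b \<Rightarrow> int) \<Rightarrow> bool" where
  "circulation G z \<longleftrightarrow>
     (\<forall>f :: 'a \<Rightarrow> int. (\<Sum>e\<in>arcs G. z e * (f (head G e) - f (tail G e))) = 0)"

lemma circulationD:
  fixes f :: "'a \<Rightarrow> int"
  assumes "circulation (G :: ('a, 'b) pre_digraph) z"
  shows "(\<Sum>e\<in>arcs G. z e * (f (head G e) - f (tail G e))) = 0"
  using assms by (auto simp: circulation_def)

lemma (in fin_digraph) circulation_dicircuit:
  assumes "K \<in> dicircuits G"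
  shows "circulation G (\<lambda>e. of_bool (e \<in> K))"
  unfolding circulation_def
  using sum_dicircuit_boundary[OF assms] dicircuit_subset_arcs[OF assms]
  by (simp add: Int_absorb1)

lemma circulation_diff:
  assumes "circulation G x" "circulation G y"
  shows "circulation G (\<lambda>e. x e - y e)"
  using assms by (simp add: circulation_def left_diff_distrib sum_subtractf)

lemma circulation_linear_combination:
  fixes a :: "'i \<Rightarrow> int"
  assumes "\<And>i. i \<in> I \<Longrightarrow> circulation G (x i)"
  shows "circulation G (\<lambda>e. \<Sum>i\<in>I. a i * x i e)"
proof -
  have "(\<Sum>e\<in>arcs G. (\<Sum>i\<in>I. a i * x i e) * (f (head G e) - f (tail G e))) = 0" for f
  proof -
    have "(\<Sum>e\<in>arcs G. (\<Sum>i\<in>I. a i * x i e) * (f (head G e) - f (tail G e)))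
        = (\<Sum>i\<in>I. \<Sum>e\<in>arcs G. a i * (x i e * (f (head G e) - f (tail G e))))"
      by (subst sum.swap) (simp add: sum_distrib_right mult.assoc)
    also have "\<dots> = (\<Sum>i\<in>I. a i * (\<Sum>e\<in>arcs G. x i e * (f (head G e) - f (tail G e))))"
      by (simp only: sum_distrib_left)
    also have "\<dots> = 0"
      using assms by (simp add: circulation_def)
    finally show ?thesis .
  qed
  then show ?thesis by (simp add: circulation_def)
qed

section \<open>Feasible potentials\<close>

text \<open>The potential of a node is the least cost of a path (without repeated nodes) that ends there.
  An arc appended to an optimal path gives either a path again, or a path followed by a
  di-circuit; in the second case dropping the di-circuit does not increase the cost.\<close>

lemma (in fin_digraph) feasible_potential:
  fixes c :: "'b \<Rightarrow> int"
  assumes nonneg: "\<And>K. K \<in> dicircuits G \<Longrightarrow> 0 \<le> (\<Sum>e\<in>K. c e)"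
  obtains \<rho> :: "'a \<Rightarrow> int" where "\<And>e. e \<in> arcs G \<Longrightarrow> \<rho> (head G e) \<le> \<rho> (tail G e) + c e"
proof -
  define cost where "cost p = (\<Sum>e\<leftarrow>p. c e)" for p
  define P where "P v = {p. \<exists>u. apath u p v}" for v
  define \<rho> where "\<rho> v = Min (cost ` P v)" for v
  have fin: "finite (P v)" for v
  proof (rule finite_subset)
    show "P v \<subseteq> (fst \<circ> snd) ` {(u, p, v). apath u p v}"
      by (force simp: P_def)
    show "finite ((fst \<circ> snd) ` {(u, p, v). apath u p v})"
      using apaths_finite_triple by simp
  qed
  have le: "\<rho> v \<le> cost p" if "apath u p v" for u p v
    unfolding \<rho>_def using that fin by (intro Min_le) (auto simp: P_def)
  have "\<rho> (head G e) \<le> \<rho> (tail G e) + c e" if e: "e \<in> arcs G" for e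
  proof -
    have "[] \<in> P (tail G e)"
      using e by (auto simp: P_def apath_Nil_iff)
    then have "\<rho> (tail G e) \<in> cost ` P (tail G e)"
      unfolding \<rho>_def using fin by (intro Min_in) auto
    then obtain u p where p: "apath u p (tail G e)" and \<rho>p: "\<rho> (tail G e) = cost p"
      by (auto simp: P_def)
    have walk: "awalk u p (tail G e)" using p by (rule awalkI_apath)
    show ?thesis
    proof (cases "head G e \<in> set (awalk_verts u p)")
      case False
      have "apath u (p @ [e]) (head G e)"
        using p e False walk awalk_verts_append[of u p "[e]" "head G e"]
        by (auto simp: apath_def awalk_simps)
      from le[OF this] show ?thesis by (simp add: \<rho>p cost_def)
    next
      case True
      obtain q r where qr: "p = q @ r" "awalk u q (head G e)" "awalk (head G e) r (tail G e)"
        using awalk_decomp[OF walk True] by blast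
      have q: "apath u q (head G e)" and r: "apath (head G e) r (tail G e)"
        using p qr by (auto simp: apath_append_iff)
      have "cycle (e # r)"
        using r e by (auto simp: cycle_def apath_def awalk_simps intro!: exI[of _ "tail G e"])
      then have "distinct (e # r)" and K: "set (e # r) \<in> dicircuits G"
        unfolding dicircuits_def by (auto simp only: cycle_conv mem_Collect_eq)
      then have "0 \<le> cost (e # r)"
        using nonneg[OF K] by (simp add: cost_def sum_list_distinct_conv_sum_set)
      then show ?thesis using le[OF q] by (simp add: \<rho>p qr(1) cost_def)
    qed
  qed
  then show thesis by (rule that)
qed

section \<open>Decomposition of circulations\<close>

text \<open>If the support contained no di-circuit, then unit cost \<open>-1\<close> would vacuously admit a feasible
  potential; it strictly decreases along every arc of the support, which contradicts conservation.\<close>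

lemma (in fin_digraph) dicircuit_in_support:
  assumes z: "circulation G z" "\<And>e. e \<in> arcs G \<Longrightarrow> 0 \<le> z e"
    and a: "a \<in> arcs G" "0 < z a"
  obtains K where "K \<in> dicircuits G" "\<And>e. e \<in> K \<Longrightarrow> 0 < z e"
proof -
  define H where "H = G\<lparr>arcs := {e \<in> arcs G. 0 < z e}\<rparr>"
  interpret H: fin_digraph H
    by unfold_locales (auto simp: H_def)
  have sub: "subgraph H G"
    by (auto simp: subgraph_def H_def compatible_def wf_digraph intro: H.wf_digraph[unfolded H_def])
  have "dicircuits H \<noteq> {}"
  proof
    assume "dicircuits H = {}"
    then obtain \<rho> where \<rho>: "\<And>e. e \<in> arcs H \<Longrightarrow> \<rho> (head H e) \<le> \<rho> (tail H e) + (-1 :: int)"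
      using H.feasible_potential[of "\<lambda>_. -1"] by blast
    have "z e * (\<rho> (head G e) - \<rho> (tail G e)) \<le> 0" if "e \<in> arcs G" for e
      using \<rho>[of e] z(2)[OF that] that by (cases "z e = 0") (auto simp: H_def mult_le_0_iff)
    moreover have "z a * (\<rho> (head G a) - \<rho> (tail G a)) < 0"
      using \<rho>[of a] a by (auto simp: H_def mult_less_0_iff)
    ultimately have "(\<Sum>e\<in>arcs G. z e * (\<rho> (head G e) - \<rho> (tail G e))) < (\<Sum>e\<in>arcs G. 0)"
      using a(1) by (intro sum_strict_mono_ex1) auto
    then show False using circulationD[OF z(1), of \<rho>] by simp
  qed
  then obtain K where K: "K \<in> dicircuits H" by blast
  then have "K \<in> dicircuits G"
    using subgraph_cycle[OF sub] by (auto simp: dicircuits_def)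
  moreover have "0 < z e" if "e \<in> K" for e
    using H.dicircuit_subset_arcs[OF K] that by (auto simp: H_def)
  ultimately show thesis by (rule that)
qed

lemma (in fin_digraph) circulation_decomposition:
  assumes "circulation G z" "\<And>e. e \<in> arcs G \<Longrightarrow> 0 \<le> z e"
  obtains M where "dicircuit_system G M"
    "\<And>e. e \<in> arcs G \<Longrightarrow> z e = int (size {#K \<in># M. e \<in> K#})"
proof -
  have "\<exists>M. dicircuit_system G M \<and> (\<forall>e\<in>arcs G. z e = int (size {#K \<in># M. e \<in> K#}))"
    using assms
  proof (induction "nat (\<Sum>e\<in>arcs G. z e)" arbitrary: z rule: less_induct)
    case less
    show ?case
    proof (cases "\<exists>a\<in>arcs G. 0 < z a")
      case False
      then have "\<forall>e\<in>arcs G. z e = 0" using less.prems(2) by force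
      then show ?thesis by (intro exI[of _ "{#}"]) (simp add: dicircuit_system_def)
    next
      case True
      then obtain K where K: "K \<in> dicircuits G" and pos: "\<And>e. e \<in> K \<Longrightarrow> 0 < z e"
        using dicircuit_in_support[OF less.prems] by blast
      define z' where "z' e = z e - of_bool (e \<in> K)" for e
      have circ: "circulation G z'"
        unfolding z'_def by (intro circulation_diff less.prems circulation_dicircuit K)
      have nonneg: "0 \<le> z' e" if "e \<in> arcs G" for e
        using pos[of e] less.prems(2)[OF that] by (auto simp: z'_def)
      have "(\<Sum>e\<in>arcs G. z' e) < (\<Sum>e\<in>arcs G. z e)"
      proof (rule sum_strict_mono_ex1)
        show "\<exists>e\<in>arcs G. z' e < z e"
          using dicircuit_nonempty[OF K] dicircuit_subset_arcs[OF K] by (auto simp: z'_def)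
      qed (auto simp: z'_def)
      moreover have "0 \<le> (\<Sum>e\<in>arcs G. z' e)"
        using nonneg by (intro sum_nonneg)
      ultimately obtain M where "dicircuit_system G M"
        and "\<forall>e\<in>arcs G. z' e = int (size {#K \<in># M. e \<in> K#})"
        using less.hyps[OF _ circ nonneg] by fastforce
      then show ?thesis using K
        by (intro exI[of _ "add_mset K M"]) (auto simp: dicircuit_system_def z'_def split: if_splits)
    qed
  qed
  then show thesis using that by blast
qed

section \<open>Minimum cost circulations with lower bounds\<close>

text \<open>The tag of an arc tells whether flow is added (\<open>True\<close>) or, against its direction, withdrawn;
  there is no capacity, so adding is always possible.\<close>

definition residual ::
  "('a, 'b) pre_digraph \<Rightarrow> ('b \<Rightarrow> int) \<Rightarrow> ('b \<Rightarrow> int) \<Rightarrow> ('a, 'b \<times> bool) pre_digraph" where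
  "residual G l z =
     \<lparr>verts = verts G,
      arcs = {(e, d). e \<in> arcs G \<and> (d \<or> l e < z e)},
      tail = (\<lambda>(e, d). if d then tail G e else head G e),
      head = (\<lambda>(e, d). if d then head G e else tail G e)\<rparr>"

lemma (in fin_digraph) fin_digraph_residual: "fin_digraph (residual G l z)"
proof
  show "finite (arcs (residual G l z))"
    by (rule finite_subset[of _ "arcs G \<times> UNIV"]) (auto simp: residual_def)
qed (auto simp: residual_def split: if_splits)

text \<open>An arc and its reversal may both lie on a residual di-circuit; their contributions then
  cancel.\<close>

lemma sum_signed_arcs:
  fixes g :: "'b \<Rightarrow> int"
  assumes "finite A" "K \<subseteq> A \<times> UNIV"
  shows "(\<Sum>e\<in>A. (of_bool ((e, True) \<in> K) - of_bool ((e, False) \<in> K)) * g e)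
       = (\<Sum>(e, d)\<in>K. if d then g e else - g e)"
proof -
  have "(\<Sum>(e, d)\<in>K. if d then g e else - g e)
      = (\<Sum>r\<in>A \<times> UNIV. of_bool (r \<in> K) * (case r of (e, d) \<Rightarrow> if d then g e else - g e))"
    using assms by (simp add: Int_absorb1)
  also have "\<dots> = (\<Sum>e\<in>A. \<Sum>d\<in>UNIV. of_bool ((e, d) \<in> K) * (if d then g e else - g e))"
    by (subst sum.cartesian_product) (simp add: case_prod_unfold)
  also have "\<dots> = (\<Sum>e\<in>A. (of_bool ((e, True) \<in> K) - of_bool ((e, False) \<in> K)) * g e)"
    by (intro sum.cong) (auto simp: UNIV_bool)
  finally show ?thesis by simp
qed

text \<open>Linear programming duality with an integral optimum on both sides. A circulation of least cost
  has no residual di-circuit of negative cost, since shifting one unit of flow along it would be an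
  improvement. A feasible potential of the residual digraph has non-negative reduced costs
  \<open>c e + \<rho> (tail G e) - \<rho> (head G e)\<close>, which vanish where the flow exceeds its lower bound, and
  passing to reduced costs does not change the cost of a circulation.\<close>

lemma (in fin_digraph) min_cost_circulation_duality:
  fixes l c z\<^sub>0 :: "'b \<Rightarrow> int"
  assumes c: "\<And>e. e \<in> arcs G \<Longrightarrow> 0 \<le> c e"
    and z\<^sub>0: "circulation G z\<^sub>0" "\<And>e. e \<in> arcs G \<Longrightarrow> l e \<le> z\<^sub>0 e"
  obtains z :: "'b \<Rightarrow> int" and \<rho> :: "'a \<Rightarrow> int" where
    "circulation G z" "\<And>e. e \<in> arcs G \<Longrightarrow> l e \<le> z e"
    "\<And>e. e \<in> arcs G \<Longrightarrow> \<rho> (head G e) \<le> \<rho> (tail G e) + c e"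
    "(\<Sum>e\<in>arcs G. c e * z e) = (\<Sum>e\<in>arcs G. l e * (c e + \<rho> (tail G e) - \<rho> (head G e)))"
proof -
  define feas where "feas z \<longleftrightarrow> circulation G z \<and> (\<forall>e\<in>arcs G. l e \<le> z e)" for z
  (* The cost above the lower bounds is non-negative, which makes the minimum exist. *)
  define excess where "excess z = (\<Sum>e\<in>arcs G. c e * (z e - l e))" for z
  have excess_nonneg: "0 \<le> excess z" if "feas z" for z
    unfolding excess_def using that c by (intro sum_nonneg) (auto simp: feas_def)
  have "feas z\<^sub>0" using z\<^sub>0 by (simp add: feas_def)
  then obtain z where z: "feas z" and opt: "\<And>z'. feas z' \<Longrightarrow> nat (excess z) \<le> nat (excess z')"
    using ex_has_least_nat[of feas z\<^sub>0 "\<lambda>z. nat (excess z)"] by blast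
  interpret R: fin_digraph "residual G l z" by (rule fin_digraph_residual)
  define cost where "cost = (\<lambda>(e, d). if d then c e else - c e)"
  have "0 \<le> (\<Sum>r\<in>K. cost r)" if K: "K \<in> dicircuits (residual G l z)" for K
  proof -
    have KR: "K \<subseteq> arcs (residual G l z)" by (rule R.dicircuit_subset_arcs[OF K])
    have KA: "K \<subseteq> arcs G \<times> UNIV" using KR by (auto simp: residual_def)
    define \<Delta> :: "'b \<Rightarrow> int" where
      "\<Delta> e = of_bool ((e, True) \<in> K) - of_bool ((e, False) \<in> K)" for e
    have circ\<Delta>: "(\<Sum>e\<in>arcs G. \<Delta> e * (f (head G e) - f (tail G e))) = 0" for f :: "'a \<Rightarrow> int"
    proof -
      have "(\<Sum>e\<in>arcs G. \<Delta> e * (f (head G e) - f (tail G e)))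
          = (\<Sum>r\<in>K. f (head (residual G l z) r) - f (tail (residual G l z) r))"
        unfolding \<Delta>_def using KA
        by (subst sum_signed_arcs) (auto simp: residual_def intro!: sum.cong)
      then show ?thesis using R.sum_dicircuit_boundary[OF K, of f] by simp
    qed
    have "feas (\<lambda>e. z e + \<Delta> e)"
      unfolding feas_def
    proof
      show "circulation G (\<lambda>e. z e + \<Delta> e)"
        using z circ\<Delta> by (simp add: feas_def circulation_def distrib_right sum.distrib)
      show "\<forall>e\<in>arcs G. l e \<le> z e + \<Delta> e"
        using z KR by (fastforce simp: feas_def \<Delta>_def residual_def)
    qed
    moreover have "excess (\<lambda>e. z e + \<Delta> e) = excess z + (\<Sum>r\<in>K. cost r)"
    proof -
      have "(\<Sum>e\<in>arcs G. \<Delta> e * c e) = (\<Sum>r\<in>K. cost r)"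
        unfolding \<Delta>_def cost_def using KA by (subst sum_signed_arcs) auto
      then show ?thesis
        by (simp add: excess_def algebra_simps sum.distrib sum_subtractf)
    qed
    ultimately show ?thesis
      using opt[of "\<lambda>e. z e + \<Delta> e"] excess_nonneg[OF z] excess_nonneg[of "\<lambda>e. z e + \<Delta> e"] by auto
  qed
  then obtain \<rho> where \<rho>: "\<And>r. r \<in> arcs (residual G l z) \<Longrightarrow>
      \<rho> (head (residual G l z) r) \<le> \<rho> (tail (residual G l z) r) + cost r"
    using R.feasible_potential by blast
  have fwd: "\<rho> (head G e) \<le> \<rho> (tail G e) + c e" if "e \<in> arcs G" for e
    using \<rho>[of "(e, True)"] that by (simp add: residual_def cost_def)
  have bwd: "\<rho> (tail G e) \<le> \<rho> (head G e) - c e" if "e \<in> arcs G" "l e < z e" for e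
    using \<rho>[of "(e, False)"] that by (simp add: residual_def cost_def)
  have slack: "z e * (c e + \<rho> (tail G e) - \<rho> (head G e)) = l e * (c e + \<rho> (tail G e) - \<rho> (head G e))"
    if "e \<in> arcs G" for e
    using fwd[OF that] bwd[OF that] z that by (cases "l e < z e") (fastforce simp: feas_def)+
  have "(\<Sum>e\<in>arcs G. c e * z e)
      = (\<Sum>e\<in>arcs G. c e * z e) - (\<Sum>e\<in>arcs G. z e * (\<rho> (head G e) - \<rho> (tail G e)))"
    using z by (simp add: feas_def circulationD)
  also have "\<dots> = (\<Sum>e\<in>arcs G. z e * (c e + \<rho> (tail G e) - \<rho> (head G e)))"
    by (simp add: sum_subtractf[symmetric] algebra_simps)
  also have "\<dots> = (\<Sum>e\<in>arcs G. l e * (c e + \<rho> (tail G e) - \<rho> (head G e)))"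
    using slack by (intro sum.cong) auto
  finally show thesis using that[of z \<rho>] z fwd by (auto simp: feas_def)
qed

section \<open>Covering weighted nodes by di-circuits\<close>

text \<open>Node \<open>v\<close> is split into an entrance \<open>(v, False)\<close> and an exit \<open>(v, True)\<close> joined by the arc
  \<open>Inr v\<close>, so that a demand at a node becomes a lower bound on an arc.\<close>

definition split_nodes :: "('a, 'b) pre_digraph \<Rightarrow> ('a \<times> bool, 'b + 'a) pre_digraph" where
  "split_nodes G =
     \<lparr>verts = verts G \<times> UNIV,
      arcs = arcs G <+> verts G,
      tail = case_sum (\<lambda>e. (tail G e, True)) (\<lambda>v. (v, False)),
      head = case_sum (\<lambda>e. (head G e, False)) (\<lambda>v. (v, True))\<rparr>"

lemma (in fin_digraph) fin_digraph_split_nodes: "fin_digraph (split_nodes G)"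
  by unfold_locales (auto simp: split_nodes_def)

lemma (in fin_digraph) sum_out_arcs:
  fixes g :: "'b \<Rightarrow> int"
  shows "(\<Sum>v\<in>verts G. \<Sum>e\<in>out_arcs G v. g e) = (\<Sum>e\<in>arcs G. g e)"
  unfolding out_arcs_def by (intro sum.group) auto

lemma (in fin_digraph) circulation_split_nodes_iff:
  "circulation (split_nodes G) z \<longleftrightarrow>
     circulation G (z \<circ> Inl) \<and> (\<forall>v\<in>verts G. z (Inr v) = (\<Sum>e\<in>out_arcs G v. z (Inl e)))"
  (is "?L \<longleftrightarrow> ?R")
proof
  have expand: "(\<Sum>a\<in>arcs (split_nodes G). z a * (f (head (split_nodes G) a) - f (tail (split_nodes G) a)))
      = (\<Sum>e\<in>arcs G. z (Inl e) * (f (head G e, False) - f (tail G e, True)))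
        + (\<Sum>v\<in>verts G. z (Inr v) * (f (v, True) - f (v, False)))" for f
    by (simp add: split_nodes_def sum.Plus)
  {
    assume L: ?L
    have "(\<Sum>e\<in>arcs G. z (Inl e) * (f (head G e) - f (tail G e))) = 0" for f :: "'a \<Rightarrow> int"
      using circulationD[OF L, of "f \<circ> fst"] unfolding expand by simp
    moreover have "z (Inr v) = (\<Sum>e\<in>out_arcs G v. z (Inl e))" if v: "v \<in> verts G" for v
    proof -
      define f :: "'a \<times> bool \<Rightarrow> int" where "f x = of_bool (x = (v, True))" for x
      have "0 = (\<Sum>e\<in>arcs G. - (of_bool (tail G e = v) * z (Inl e)))
          + (\<Sum>u\<in>verts G. of_bool (u = v) * z (Inr u))"
        using circulationD[OF L, of f] unfolding expand by (simp add: f_def mult.commute)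
      also have "\<dots> = z (Inr v) - (\<Sum>e\<in>out_arcs G v. z (Inl e))"
        using v by (simp add: sum_negf out_arcs_def Collect_conj_eq)
      finally show ?thesis by simp
    qed
    ultimately show ?R by (simp add: circulation_def)
  next
    assume R: ?R
    have "(\<Sum>a\<in>arcs (split_nodes G). z a * (f (head (split_nodes G) a) - f (tail (split_nodes G) a))) = 0"
      for f
    proof -
      have "(\<Sum>v\<in>verts G. z (Inr v) * (f (v, True) - f (v, False)))
          = (\<Sum>v\<in>verts G. \<Sum>e\<in>out_arcs G v. z (Inl e) * (f (tail G e, True) - f (tail G e, False)))"
        using R by (intro sum.cong) (auto simp: sum_distrib_right out_arcs_def)
      also have "\<dots> = (\<Sum>e\<in>arcs G. z (Inl e) * (f (tail G e, True) - f (tail G e, False)))"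
        by (rule sum_out_arcs)
      finally have "(\<Sum>a\<in>arcs (split_nodes G). z a * (f (head (split_nodes G) a) - f (tail (split_nodes G) a)))
          = (\<Sum>e\<in>arcs G. z (Inl e) * (f (head G e, False) - f (tail G e, False)))"
        unfolding expand by (simp add: sum.distrib[symmetric] algebra_simps)
      also have "\<dots> = 0"
        using R circulationD[of G "z \<circ> Inl" "\<lambda>v. f (v, False)"] by simp
      finally show ?thesis .
    qed
    then show ?L by (simp add: circulation_def)
  }
qed

lemma (in fin_digraph) dicircuit_out_arcs:
  assumes "K \<in> dicircuits G"
  shows "(\<Sum>e\<in>out_arcs G v. of_bool (e \<in> K)) = (of_bool (v \<in> dicircuit_verts G K) :: int)"
proof (cases "v \<in> dicircuit_verts G K")
  case True
  then obtain a where a: "a \<in> K" "tail G a = v"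
    using dicircuit_verts_eq_tails[OF assms] by auto
  then have "out_arcs G v \<inter> K = {a}"
    using dicircuit_inj_on_tail[OF assms] dicircuit_subset_arcs[OF assms]
    by (auto simp: out_arcs_def inj_on_def)
  then show ?thesis using True by (simp add: out_arcs_def)
next
  case False
  then have "out_arcs G v \<inter> K = {}"
    using dicircuit_verts_eq_tails[OF assms] by (auto simp: out_arcs_def)
  then show ?thesis using False by (simp add: out_arcs_def)
qed

lemma (in fin_digraph) dicircuit_system_cost:
  fixes c :: "'b \<Rightarrow> int"
  assumes "dicircuit_system G M"
  shows "(\<Sum>K\<in>#M. \<Sum>e\<in>K. c e) = (\<Sum>e\<in>arcs G. c e * int (size {#K \<in># M. e \<in> K#}))"
  using assms
proof (induction M)
  case (add K M)
  then have K: "K \<in> dicircuits G" by (simp add: dicircuit_system_def)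
  have "(\<Sum>e\<in>arcs G. c e * int (size {#K' \<in># add_mset K M. e \<in> K'#}))
      = (\<Sum>e\<in>arcs G. of_bool (e \<in> K) * c e + c e * int (size {#K' \<in># M. e \<in> K'#}))"
    by (intro sum.cong) (auto simp: algebra_simps)
  also have "\<dots> = (\<Sum>e\<in>K. c e) + (\<Sum>e\<in>arcs G. c e * int (size {#K' \<in># M. e \<in> K'#}))"
    using dicircuit_subset_arcs[OF K] by (simp add: sum.distrib Int_absorb1)
  finally show ?case using add by (simp add: dicircuit_system_def)
qed simp

lemma (in fin_digraph) dicircuit_system_throughput:
  assumes "dicircuit_system G M"
  shows "(\<Sum>e\<in>out_arcs G v. int (size {#K \<in># M. e \<in> K#}))
       = int (size {#K \<in># M. v \<in> dicircuit_verts G K#})"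
  using assms
proof (induction M)
  case (add K M)
  then have K: "K \<in> dicircuits G" by (simp add: dicircuit_system_def)
  have "(\<Sum>e\<in>out_arcs G v. int (size {#K' \<in># add_mset K M. e \<in> K'#}))
      = (\<Sum>e\<in>out_arcs G v. of_bool (e \<in> K) + int (size {#K' \<in># M. e \<in> K'#}))"
    by (intro sum.cong) auto
  then show ?case
    using add dicircuit_out_arcs[OF K, of v]
    by (simp add: sum.distrib dicircuit_system_def del: sum_of_bool_eq)
qed simp

text \<open>In the node-split digraph, with the weights as lower bounds on the arcs inside the nodes,
  the reduced cost of the arc \<open>Inr v\<close> is the dual variable \<open>y v\<close> of the demand at \<open>v\<close>, and the
  negated potentials of the entrances form \<open>\<pi>\<close>.\<close>

lemma (in fin_digraph) node_cover_duality:
  fixes c :: "'b \<Rightarrow> int" and w :: "'a \<Rightarrow> nat"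
  assumes c: "\<And>e. e \<in> arcs G \<Longrightarrow> 0 \<le> c e"
    and coverable: "\<And>v. v \<in> verts G \<Longrightarrow> \<exists>K\<in>dicircuits G. v \<in> dicircuit_verts G K"
  obtains M and y \<pi> :: "'a \<Rightarrow> int" where
    "dicircuit_system G M" "covers_weight G M w"
    "\<And>v. v \<in> verts G \<Longrightarrow> 0 \<le> y v"
    "\<And>e. e \<in> arcs G \<Longrightarrow> y (tail G e) \<le> c e + \<pi> (head G e) - \<pi> (tail G e)"
    "(\<Sum>K\<in>#M. \<Sum>e\<in>K. c e) = (\<Sum>v\<in>verts G. int (w v) * y v)"
proof -
  interpret S: fin_digraph "split_nodes G" by (rule fin_digraph_split_nodes)
  obtain C where C: "\<And>v. v \<in> verts G \<Longrightarrow> C v \<in> dicircuits G \<and> v \<in> dicircuit_verts G (C v)"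
    using coverable by metis
  define x\<^sub>0 where "x\<^sub>0 e = (\<Sum>v\<in>verts G. int (w v) * of_bool (e \<in> C v))" for e
  define z\<^sub>0 where "z\<^sub>0 = case_sum x\<^sub>0 (\<lambda>v. \<Sum>e\<in>out_arcs G v. x\<^sub>0 e)"
  define l where "l = case_sum (\<lambda>e :: 'b. 0 :: int) (\<lambda>v. int (w v))"
  define c' where "c' = case_sum c (\<lambda>v :: 'a. 0)"
  have "circulation G x\<^sub>0"
    unfolding x\<^sub>0_def using C by (intro circulation_linear_combination circulation_dicircuit) auto
  then have circ: "circulation (split_nodes G) z\<^sub>0"
    unfolding circulation_split_nodes_iff by (auto simp: z\<^sub>0_def comp_def)
  have x\<^sub>0_nonneg: "0 \<le> x\<^sub>0 e" for e
    unfolding x\<^sub>0_def by (intro sum_nonneg) auto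
  have "int (w v) \<le> (\<Sum>e\<in>out_arcs G v. x\<^sub>0 e)" if v: "v \<in> verts G" for v
  proof -
    obtain a where a: "a \<in> C v" "tail G a = v"
      using C[OF v] dicircuit_verts_eq_tails by auto
    have "int (w v) = int (w v) * of_bool (a \<in> C v)" using a by simp
    also have "\<dots> \<le> x\<^sub>0 a"
      unfolding x\<^sub>0_def using v by (intro member_le_sum) auto
    also have "\<dots> \<le> (\<Sum>e\<in>out_arcs G v. x\<^sub>0 e)"
      using a C[OF v] dicircuit_subset_arcs x\<^sub>0_nonneg
      by (intro member_le_sum) (auto simp: out_arcs_def)
    finally show ?thesis .
  qed
  then have bound: "l a \<le> z\<^sub>0 a" if "a \<in> arcs (split_nodes G)" for a
    using that x\<^sub>0_nonneg by (auto simp: split_nodes_def l_def z\<^sub>0_def)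
  have c'_nonneg: "0 \<le> c' a" if "a \<in> arcs (split_nodes G)" for a
    using that c by (auto simp: split_nodes_def c'_def)
  obtain z \<rho> where z: "circulation (split_nodes G) z" "\<And>a. a \<in> arcs (split_nodes G) \<Longrightarrow> l a \<le> z a"
    and \<rho>: "\<And>a. a \<in> arcs (split_nodes G) \<Longrightarrow>
        \<rho> (head (split_nodes G) a) \<le> \<rho> (tail (split_nodes G) a) + c' a"
    and opt: "(\<Sum>a\<in>arcs (split_nodes G). c' a * z a)
        = (\<Sum>a\<in>arcs (split_nodes G).
             l a * (c' a + \<rho> (tail (split_nodes G) a) - \<rho> (head (split_nodes G) a)))"
    using S.min_cost_circulation_duality[where c = c', OF c'_nonneg circ bound] by blast
  have x: "circulation G (z \<circ> Inl)"
    and thru: "\<And>v. v \<in> verts G \<Longrightarrow> z (Inr v) = (\<Sum>e\<in>out_arcs G v. z (Inl e))"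
    using z(1) by (auto simp: circulation_split_nodes_iff)
  have "0 \<le> (z \<circ> Inl) e" if "e \<in> arcs G" for e
    using z(2)[of "Inl e"] that by (auto simp: split_nodes_def l_def)
  then obtain M where M: "dicircuit_system G M"
    and mult: "\<And>e. e \<in> arcs G \<Longrightarrow> (z \<circ> Inl) e = int (size {#K \<in># M. e \<in> K#})"
    using circulation_decomposition[OF x] by metis
  define y where "y v = \<rho> (v, False) - \<rho> (v, True)" for v
  define \<pi> where "\<pi> v = - \<rho> (v, False)" for v
  show thesis
  proof (rule that[OF M])
    show "covers_weight G M w"
      unfolding covers_weight_def
    proof
      fix v assume v: "v \<in> verts G"
      have "int (w v) \<le> (\<Sum>e\<in>out_arcs G v. z (Inl e))"
        using z(2)[of "Inr v"] thru[OF v] v by (auto simp: split_nodes_def l_def)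
      also have "\<dots> = (\<Sum>e\<in>out_arcs G v. int (size {#K \<in># M. e \<in> K#}))"
        using mult by (intro sum.cong) (auto simp: out_arcs_def)
      also have "\<dots> = int (size {#K \<in># M. v \<in> dicircuit_verts G K#})"
        by (rule dicircuit_system_throughput[OF M])
      finally show "w v \<le> size {#K \<in># M. v \<in> dicircuit_verts G K#}" by simp
    qed
    show "0 \<le> y v" if "v \<in> verts G" for v
      using \<rho>[of "Inr v"] that by (auto simp: split_nodes_def c'_def y_def)
    show "y (tail G e) \<le> c e + \<pi> (head G e) - \<pi> (tail G e)" if "e \<in> arcs G" for e
      using \<rho>[of "Inl e"] that by (force simp: split_nodes_def c'_def y_def \<pi>_def)
    have "(\<Sum>K\<in>#M. \<Sum>e\<in>K. c e) = (\<Sum>e\<in>arcs G. c e * z (Inl e))"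
      using mult by (simp add: dicircuit_system_cost[OF M])
    also have "\<dots> = (\<Sum>v\<in>verts G. int (w v) * y v)"
      using opt by (simp add: split_nodes_def sum.Plus c'_def l_def y_def)
    finally show "(\<Sum>K\<in>#M. \<Sum>e\<in>K. c e) = (\<Sum>v\<in>verts G. int (w v) * y v)" .
  qed
qed

section \<open>Stable sets as potentials\<close>

text \<open>A family of pairwise disjoint dicuts is the same as a function on the nodes that increases by
  0 or 1 along every arc: the function counts the sides \<open>Z\<close> that contain a node, and conversely the
  dicuts are those entering its upper level sets. The arcs of increase 1 are the reversed ones.\<close>

lemma (in fin_digraph) sink_stable_iff_potential:
  "sink_stable G S \<longleftrightarrow> S \<subseteq> verts G \<and>
     (\<exists>\<pi> :: 'a \<Rightarrow> int. \<forall>e\<in>arcs G.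
        of_bool (tail G e \<in> S) \<le> \<pi> (head G e) - \<pi> (tail G e) \<and>
        \<pi> (head G e) - \<pi> (tail G e) \<le> 1 - of_bool (head G e \<in> S))"
  (is "?L \<longleftrightarrow> _ \<and> (\<exists>\<pi>. ?P \<pi>)")
proof
  assume ?L
  then obtain \<C> where \<C>: "\<C> \<subseteq> dicuts G" "disjoint \<C>" and sink: "sink_set (reorient G (\<Union>\<C>)) S"
    by (auto simp: sink_stable_def)
  have "\<forall>B\<in>\<C>. \<exists>Z. B = entering G Z \<and> leaving G Z = {}"
    using \<C>(1) by (auto simp: dicuts_def)
  then obtain Z where Z: "\<And>B. B \<in> \<C> \<Longrightarrow> B = entering G (Z B) \<and> leaving G (Z B) = {}"
    by metis
  have "\<C> \<subseteq> Pow (arcs G)" using Z by (auto simp: entering_def)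
  then have fin: "finite \<C>" by (rule finite_subset) simp
  define \<pi> :: "'a \<Rightarrow> int" where "\<pi> v = (\<Sum>B\<in>\<C>. of_bool (v \<in> Z B))" for v
  have diff: "\<pi> (head G e) - \<pi> (tail G e) = of_bool (e \<in> \<Union>\<C>)" if e: "e \<in> arcs G" for e
  proof -
    have "\<pi> (head G e) - \<pi> (tail G e) = (\<Sum>B\<in>\<C>. of_bool (head G e \<in> Z B) - of_bool (tail G e \<in> Z B))"
      by (simp only: \<pi>_def sum_subtractf)
    also have "\<dots> = (\<Sum>B\<in>\<C>. of_bool (e \<in> B))"
    proof (rule sum.cong)
      fix B assume "B \<in> \<C>"
      then have "e \<in> B \<longleftrightarrow> e \<in> entering G (Z B)" "leaving G (Z B) = {}"
        using Z by blast+
      then show "of_bool (head G e \<in> Z B) - of_bool (tail G e \<in> Z B) = (of_bool (e \<in> B) :: int)"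
        using e by (auto simp: entering_def leaving_def)
    qed simp
    also have "\<dots> = of_bool (e \<in> \<Union>\<C>)"
    proof (cases "e \<in> \<Union>\<C>")
      case True
      then obtain B where B: "B \<in> \<C>" "e \<in> B" by blast
      then have "\<C> \<inter> {B. e \<in> B} = {B}"
        using \<C>(2) by (auto simp: disjoint_def)
      then show ?thesis using True fin by simp
    next
      case False
      then have "\<C> \<inter> {B. e \<in> B} = {}" by blast
      then show ?thesis using False fin by simp
    qed
    finally show ?thesis .
  qed
  have S: "S \<subseteq> verts G" using sink by (simp add: sink_set_def reorient_def)
  have no_out: "out_arcs (reorient G (\<Union>\<C>)) v = {}" if "v \<in> S" for v
    using sink that by (simp add: sink_set_def)
  have "e \<in> \<Union>\<C>" if "e \<in> arcs G" "tail G e \<in> S" for e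
  proof (rule ccontr)
    assume "e \<notin> \<Union>\<C>"
    then have "e \<in> out_arcs (reorient G (\<Union>\<C>)) (tail G e)"
      using that(1) by (simp add: out_arcs_def reorient_def del: Union_iff)
    then show False using no_out[OF that(2)] by blast
  qed
  moreover have "e \<notin> \<Union>\<C>" if "e \<in> arcs G" "head G e \<in> S" for e
  proof
    assume "e \<in> \<Union>\<C>"
    then have "e \<in> out_arcs (reorient G (\<Union>\<C>)) (head G e)"
      using that(1) by (simp add: out_arcs_def reorient_def del: Union_iff)
    then show False using no_out[OF that(2)] by blast
  qed
  ultimately have "?P \<pi>" using diff by (auto simp del: Union_iff)
  with S show "S \<subseteq> verts G \<and> (\<exists>\<pi>. ?P \<pi>)" by blast
next
  assume "S \<subseteq> verts G \<and> (\<exists>\<pi>. ?P \<pi>)"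
  then obtain \<pi> where S: "S \<subseteq> verts G" and \<pi>: "?P \<pi>" by blast
  (* Only the levels attained by the potential give non-empty dicuts. *)
  define B where "B k = entering G {v \<in> verts G. k \<le> \<pi> v}" for k
  have mono: "\<pi> (tail G e) \<le> \<pi> (head G e)" and step: "\<pi> (head G e) \<le> \<pi> (tail G e) + 1"
    if "e \<in> arcs G" for e
    using \<pi> that by (force simp: of_bool_def split: if_splits)+
  have mem: "e \<in> B k \<longleftrightarrow> e \<in> arcs G \<and> \<pi> (tail G e) < k \<and> k = \<pi> (head G e)" for e k
    using step[of e] by (auto simp: B_def entering_def)
  have "B k \<in> dicuts G" for k
  proof -
    have "leaving G {v \<in> verts G. k \<le> \<pi> v} = {}"
      using mono by (force simp: leaving_def)
    then show ?thesis by (auto simp: B_def dicuts_def)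
  qed
  moreover have "disjoint (range B)"
    by (auto simp: disjoint_def mem)
  moreover have "sink_set (reorient G (\<Union>(range B))) S"
    unfolding sink_set_def
  proof (intro conjI ballI)
    show "S \<subseteq> verts (reorient G (\<Union>(range B)))" using S by (simp add: reorient_def)
    fix v assume v: "v \<in> S"
    have "\<pi> (tail G e) < \<pi> (head G e)" if "e \<in> arcs G" "tail G e = v" for e
      using \<pi> that v by force
    moreover have "\<pi> (head G e) \<le> \<pi> (tail G e)" if "e \<in> arcs G" "head G e = v" for e
      using \<pi> that v by force
    ultimately show "out_arcs (reorient G (\<Union>(range B))) v = {}"
      by (fastforce simp: out_arcs_def reorient_def mem split: if_splits)
  qed
  ultimately show ?L unfolding sink_stable_def by blast
qed

text \<open>Reversing an arc of \<open>F\<close> replaces the increase \<open>t\<close> along it by \<open>- t\<close> and exchanges the roles of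
  its ends; in terms of \<open>1 + t\<close> the condition becomes the one for the arcs outside \<open>F\<close>.\<close>

lemma (in fin_digraph) F_stable_iff_potential:
  "F_stable G F S \<longleftrightarrow> S \<subseteq> verts G \<and>
     (\<exists>\<pi> :: 'a \<Rightarrow> int. \<forall>e\<in>arcs G.
        of_bool (tail G e \<in> S) \<le> of_bool (e \<in> F) + \<pi> (head G e) - \<pi> (tail G e) \<and>
        of_bool (e \<in> F) + \<pi> (head G e) - \<pi> (tail G e) \<le> 1 - of_bool (head G e \<in> S))"
proof -
  interpret R: fin_digraph "reorient G F"
    by unfold_locales (auto simp: reorient_def)
  have *: "of_bool (tail (reorient G F) e \<in> S) \<le> \<pi> (head (reorient G F) e) - \<pi> (tail (reorient G F) e) \<and>
        \<pi> (head (reorient G F) e) - \<pi> (tail (reorient G F) e) \<le> 1 - of_bool (head (reorient G F) e \<in> S)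
      \<longleftrightarrow> of_bool (tail G e \<in> S) \<le> of_bool (e \<in> F) + \<pi> (head G e) - \<pi> (tail G e) \<and>
        of_bool (e \<in> F) + \<pi> (head G e) - \<pi> (tail G e) \<le> 1 - of_bool (head G e \<in> S)"
    for e and \<pi> :: "'a \<Rightarrow> int"
    by (cases "e \<in> F") (auto simp: reorient_def)
  have verts_arcs: "verts (reorient G F) = verts G" "arcs (reorient G F) = arcs G"
    by (simp_all add: reorient_def)
  show ?thesis
    unfolding F_stable_def R.sink_stable_iff_potential * verts_arcs ..
qed

lemma (in fin_digraph) F_stable_subset:
  assumes "F_stable G F S" "T \<subseteq> S"
  shows "F_stable G F T"
proof -
  obtain \<pi> :: "'a \<Rightarrow> int" where S: "S \<subseteq> verts G" and \<pi>: "\<forall>e\<in>arcs G.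
        of_bool (tail G e \<in> S) \<le> of_bool (e \<in> F) + \<pi> (head G e) - \<pi> (tail G e) \<and>
        of_bool (e \<in> F) + \<pi> (head G e) - \<pi> (tail G e) \<le> 1 - of_bool (head G e \<in> S)"
    using assms(1) unfolding F_stable_iff_potential by blast
  have le: "of_bool (v \<in> T) \<le> (of_bool (v \<in> S) :: int)" for v
    using assms(2) by auto
  show ?thesis
    unfolding F_stable_iff_potential
  proof (intro conjI exI[of _ \<pi>] ballI)
    show "T \<subseteq> verts G" using S assms(2) by blast
    fix e assume "e \<in> arcs G"
    note e = bspec[OF \<pi> this]
    show "of_bool (tail G e \<in> T) \<le> of_bool (e \<in> F) + \<pi> (head G e) - \<pi> (tail G e)"
      using e le[of "tail G e"] by linarith
    show "of_bool (e \<in> F) + \<pi> (head G e) - \<pi> (tail G e) \<le> 1 - of_bool (head G e \<in> T)"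
      using e le[of "head G e"] by linarith
  qed
qed

section \<open>The min-max relation\<close>

text \<open>Along a di-circuit the potential differences cancel, and distinct arcs have distinct
  tails; so adding up the lower bounds counts each node of \<open>S\<close> on \<open>K\<close> once.\<close>

lemma (in fin_digraph) card_F_stable_Int_dicircuit:
  assumes "F_stable G F S" and K: "K \<in> dicircuits G"
  shows "card (S \<inter> dicircuit_verts G K) \<le> F_value F K"
proof -
  obtain \<pi> :: "'a \<Rightarrow> int" where \<pi>: "\<And>e. e \<in> arcs G \<Longrightarrow>
      of_bool (tail G e \<in> S) \<le> of_bool (e \<in> F) + \<pi> (head G e) - \<pi> (tail G e)"
    using assms(1) unfolding F_stable_iff_potential by blast
  have fin: "finite K" by (rule dicircuit_finite[OF K])
  have "S \<inter> dicircuit_verts G K = tail G ` {e \<in> K. tail G e \<in> S}"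
    using dicircuit_verts_eq_tails[OF K] by auto
  then have "card (S \<inter> dicircuit_verts G K) = card {e \<in> K. tail G e \<in> S}"
    using dicircuit_inj_on_tail[OF K] by (simp add: card_image inj_on_subset)
  then have "int (card (S \<inter> dicircuit_verts G K)) = (\<Sum>e\<in>K. of_bool (tail G e \<in> S))"
    using fin by (simp add: Int_def)
  also have "\<dots> \<le> (\<Sum>e\<in>K. of_bool (e \<in> F) + (\<pi> (head G e) - \<pi> (tail G e)))"
    using \<pi> dicircuit_subset_arcs[OF K] by (intro sum_mono) (metis add_diff_eq subset_iff)
  also have "\<dots> = int (F_value F K)"
    unfolding sum.distrib sum_dicircuit_boundary[OF K]
    using fin by (simp add: F_value_def Int_commute)
  finally show ?thesis by simp
qed

lemma (in fin_digraph) weight_F_stable_le_cover: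
  assumes S: "F_stable G F S" and M: "dicircuit_system G M" "covers_weight G M w"
  shows "(\<Sum>v\<in>S. w v) \<le> total_F_value F M"
proof -
  have SV: "S \<subseteq> verts G" using S unfolding F_stable_iff_potential by blast
  then have fin: "finite S" by (rule finite_subset) simp
  have "(\<Sum>v\<in>S. w v) \<le> (\<Sum>v\<in>S. size {#K \<in># M. v \<in> dicircuit_verts G K#})"
    using M(2) SV by (intro sum_mono) (auto simp: covers_weight_def)
  also have "\<dots> = (\<Sum>K\<in>#M. card (S \<inter> dicircuit_verts G K))"
  proof (induction M)
    case (add K M)
    have "(\<Sum>v\<in>S. size {#K' \<in># add_mset K M. v \<in> dicircuit_verts G K'#})
        = (\<Sum>v\<in>S. of_bool (v \<in> dicircuit_verts G K) + size {#K' \<in># M. v \<in> dicircuit_verts G K'#})"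
      by (intro sum.cong) auto
    then show ?case using add fin by (simp add: sum.distrib)
  qed simp
  also have "\<dots> \<le> total_F_value F M"
    unfolding total_F_value_def using M(1) card_F_stable_Int_dicircuit[OF S]
    by (intro sum_mset_mono) (auto simp: dicircuit_system_def)
  finally show ?thesis .
qed

lemma (in wf_digraph) strongly_connected_arc_on_dicircuit:
  assumes "strongly_connected G" "e \<in> arcs G"
  obtains K where "K \<in> dicircuits G" "e \<in> K"
proof -
  obtain p where p: "apath (head G e) p (tail G e)"
    using assms by (meson strongly_connected_def reachable_apath wellformed)
  then have "cycle (e # p)"
    using assms(2) by (auto simp: cycle_def apath_def awalk_simps intro!: exI[of _ "tail G e"])
  then have "set (e # p) \<in> dicircuits G" unfolding dicircuits_def by blast
  then show thesis using that by simp
qed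

lemma (in wf_digraph) strongly_connected_arc_leaving:
  assumes "strongly_connected G" "card (verts G) \<ge> 2" "v \<in> verts G"
  obtains e where "e \<in> arcs G" "tail G e = v"
proof -
  have "verts G \<noteq> {v}" using assms(2) by auto
  then obtain u where "u \<in> verts G" "u \<noteq> v" using assms(3) by blast
  then obtain p where "awalk v p u"
    using assms(1,3) by (auto simp: strongly_connected_def reachable_awalk)
  with \<open>u \<noteq> v\<close> show thesis using that by (cases p) (auto simp: awalk_simps)
qed

text \<open>Flatness supplies the upper bounds, which the linear program does not impose. Let
  \<open>s a\<close> be \<open>[a \<in> F] + \<pi> (head G a) - \<pi> (tail G a)\<close>. On a di-circuit through \<open>e\<close> with \<open>F\<close>-value 1
  these numbers are non-negative and add up to 1. The arc of it that leaves the head of \<open>e\<close> is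
  different from \<open>e\<close>, as there are no loops, and its \<open>s\<close> is already at least \<open>y (head G e)\<close>.\<close>

lemma (in fin_loopfree_digraph) flat_slack_bound:
  fixes y \<pi> :: "'a \<Rightarrow> int"
  assumes "flat G F" "strongly_connected G"
    and y: "\<And>v. v \<in> verts G \<Longrightarrow> 0 \<le> y v"
    and dual: "\<And>e. e \<in> arcs G \<Longrightarrow> y (tail G e) \<le> of_bool (e \<in> F) + \<pi> (head G e) - \<pi> (tail G e)"
    and e: "e \<in> arcs G"
  shows "of_bool (e \<in> F) + \<pi> (head G e) - \<pi> (tail G e) \<le> 1 - y (head G e)"
proof -
  define s where "s a = of_bool (a \<in> F) + (\<pi> (head G a) - \<pi> (tail G a))" for a
  have "cyclic_arc G e"
    using strongly_connected_arc_on_dicircuit[OF assms(2) e] by (auto simp: cyclic_arc_def)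
  then obtain K where K: "K \<in> dicircuits G" "e \<in> K" "card (F \<inter> K) = 1"
    using assms(1) e by (auto simp: flat_def)
  have fin: "finite K" and KA: "K \<subseteq> arcs G"
    using dicircuit_finite[OF K(1)] dicircuit_subset_arcs[OF K(1)] by auto
  have "head G e \<in> dicircuit_verts G K" using K(2) by (simp add: dicircuit_verts_def)
  then obtain a where a: "a \<in> K" "tail G a = head G e"
    using dicircuit_verts_eq_tails[OF K(1)] by auto
  have "a \<noteq> e" using a no_loops[OF e] by auto
  have "s e + y (head G e) \<le> s e + s a"
    using dual[of a] a KA by (auto simp: s_def)
  also have "\<dots> = (\<Sum>b\<in>{e, a}. s b)" using \<open>a \<noteq> e\<close> by simp
  also have "\<dots> \<le> (\<Sum>b\<in>K. s b)"
  proof (rule sum_mono2[OF fin])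
    show "{e, a} \<subseteq> K" using a K(2) by blast
    fix b assume "b \<in> K - {e, a}"
    then have b: "b \<in> arcs G" using KA by blast
    show "0 \<le> s b" using dual[OF b] y[of "tail G b"] b by (simp add: s_def)
  qed
  also have "\<dots> = 1"
    unfolding s_def sum.distrib sum_dicircuit_boundary[OF K(1)]
    using fin K(3) by (simp add: Int_commute)
  finally show ?thesis by (simp add: s_def)
qed

text \<open>The dual variables are 0 or 1: a node \<open>v\<close> is the tail of some arc \<open>e\<close>, and
  \<open>[e \<in> F] + \<pi> (head G e) - \<pi> (tail G e)\<close> is at least \<open>y v\<close> and at most 1.\<close>

lemma (in fin_loopfree_digraph) F_stable_cover_equality:
  fixes w :: "'a \<Rightarrow> nat"
  assumes conn: "strongly_connected G" "card (verts G) \<ge> 2" and flat: "flat G F"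
  obtains S M where "F_stable G F S" "dicircuit_system G M" "covers_weight G M w"
    "(\<Sum>v\<in>S. w v) = total_F_value F M"
proof -
  have coverable: "\<exists>K\<in>dicircuits G. v \<in> dicircuit_verts G K" if v: "v \<in> verts G" for v
  proof -
    obtain e where e: "e \<in> arcs G" "tail G e = v"
      using strongly_connected_arc_leaving[OF conn v] .
    then show ?thesis
      using strongly_connected_arc_on_dicircuit[OF conn(1) e(1)] by (auto simp: dicircuit_verts_def)
  qed
  have "0 \<le> (of_bool (e \<in> F) :: int)" for e by simp
  from node_cover_duality[where c = "\<lambda>e. of_bool (e \<in> F)" and w = w, OF this coverable]
  obtain M and y \<pi> :: "'a \<Rightarrow> int" where M: "dicircuit_system G M" "covers_weight G M w"
    and y: "\<And>v. v \<in> verts G \<Longrightarrow> 0 \<le> y v"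
    and dual: "\<And>e. e \<in> arcs G \<Longrightarrow> y (tail G e) \<le> of_bool (e \<in> F) + \<pi> (head G e) - \<pi> (tail G e)"
    and opt: "(\<Sum>K\<in>#M. \<Sum>e\<in>K. of_bool (e \<in> F)) = (\<Sum>v\<in>verts G. int (w v) * y v)"
    by blast
  have bound: "of_bool (e \<in> F) + \<pi> (head G e) - \<pi> (tail G e) \<le> 1 - y (head G e)"
    if "e \<in> arcs G" for e
    using flat_slack_bound[OF flat conn(1) _ _ that] y dual by blast
  define S where "S = {v \<in> verts G. y v = 1}"
  have y_le: "y v \<le> 1" if v: "v \<in> verts G" for v
  proof -
    obtain e where e: "e \<in> arcs G" "tail G e = v"
      using strongly_connected_arc_leaving[OF conn v] .
    show ?thesis using dual[OF e(1)] bound[OF e(1)] y[of "head G e"] e by simp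
  qed
  have y_eq: "y v = of_bool (v \<in> S)" if "v \<in> verts G" for v
    using y[OF that] y_le[OF that] that by (auto simp: S_def)
  have stable: "F_stable G F S"
    unfolding F_stable_iff_potential
  proof (intro conjI exI[of _ \<pi>] ballI)
    fix e assume e: "e \<in> arcs G"
    show "of_bool (tail G e \<in> S) \<le> of_bool (e \<in> F) + \<pi> (head G e) - \<pi> (tail G e)"
      using dual[OF e] y_eq[of "tail G e"] e by simp
    show "of_bool (e \<in> F) + \<pi> (head G e) - \<pi> (tail G e) \<le> 1 - of_bool (head G e \<in> S)"
      using bound[OF e] y_eq[of "head G e"] e by simp
  qed (simp add: S_def)
  have "int (\<Sum>v\<in>S. w v) = int (total_F_value F M)"
  proof -
    have "int (\<Sum>v\<in>S. w v) = (\<Sum>v\<in>verts G. of_bool (v \<in> S) * int (w v))"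
      by (simp add: S_def Int_def)
    also have "\<dots> = (\<Sum>v\<in>verts G. int (w v) * y v)"
      using y_eq by (intro sum.cong) auto
    also have "\<dots> = (\<Sum>K\<in>#M. int (F_value F K))"
      unfolding opt[symmetric] using M(1) dicircuit_finite
      by (intro arg_cong[of _ _ sum_mset] image_mset_cong)
        (auto simp: F_value_def dicircuit_system_def Int_commute)
    also have "\<dots> = int (total_F_value F M)"
      by (simp add: total_F_value_def of_nat_sum_mset image_mset.compositionality comp_def)
    finally show ?thesis .
  qed
  then have "(\<Sum>v\<in>S. w v) = total_F_value F M" by (simp only: of_nat_eq_iff)
  with stable M show thesis by (rule that)
qed

lemma covers_set_iff_covers_weight:
  assumes "U \<subseteq> verts D"
  shows "covers_set D M U \<longleftrightarrow> covers_weight D M (\<lambda>v. of_bool (v \<in> U))"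
proof -
  have "(\<exists>K\<in>#M. P K) \<longleftrightarrow> 1 \<le> size {#K \<in># M. P K#}" for P
    by (auto simp: Suc_le_eq nonempty_has_size[symmetric])
  then show ?thesis
    using assms by (auto simp: covers_set_def covers_weight_def)
qed

theorem theorem4p7:
  fixes D :: "('a, 'b) pre_digraph" and F :: "'b set" and w :: "'a \<Rightarrow> nat" and U :: "'a set"
  assumes "fin_loopfree_digraph D"
    and "strongly_connected D"
    and "card (verts D) \<ge> 2"
    and "flat D F"
    and "U \<subseteq> verts D"
  shows "(\<exists>m. is_maximum {\<Sum>v\<in>S. w v | S. F_stable D F S} m \<and>
              is_minimum {total_F_value F M | M. dicircuit_system D M \<and> covers_weight D M w} m) \<and>
         (\<exists>m. is_maximum {card S | S. F_stable D F S \<and> S \<subseteq> U} m \<and>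
              is_minimum {total_F_value F M | M. dicircuit_system D M \<and> covers_set D M U} m)"
proof
  interpret fin_loopfree_digraph D by (rule assms(1))
  note strong = F_stable_cover_equality[OF assms(2-4)]
  obtain S M where SM: "F_stable D F S" "dicircuit_system D M" "covers_weight D M w"
    "(\<Sum>v\<in>S. w v) = total_F_value F M"
    by (rule strong)
  show "\<exists>m. is_maximum {\<Sum>v\<in>S. w v | S. F_stable D F S} m \<and>
      is_minimum {total_F_value F M | M. dicircuit_system D M \<and> covers_weight D M w} m"
  proof (intro exI conjI)
    show "is_maximum {\<Sum>v\<in>S. w v | S. F_stable D F S} (total_F_value F M)"
      unfolding is_maximum_def using SM(1,4) weight_F_stable_le_cover[OF _ SM(2,3)] by force
    show "is_minimum {total_F_value F M | M. dicircuit_system D M \<and> covers_weight D M w}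
        (total_F_value F M)"
      unfolding is_minimum_def using SM weight_F_stable_le_cover[OF SM(1)] by force
  qed
  (* For the part on U the weight of a stable set S is the size of the stable set S \<inter> U. *)
  let ?w = "\<lambda>v. of_bool (v \<in> U) :: nat"
  obtain S M where SM: "F_stable D F S" "dicircuit_system D M" "covers_weight D M ?w"
    "(\<Sum>v\<in>S. ?w v) = total_F_value F M"
    by (rule strong)
  have fin: "finite T" if "F_stable D F T" for T
    using that unfolding F_stable_iff_potential by (meson finite_subset finite_verts)
  have weight: "(\<Sum>v\<in>T. ?w v) = card (T \<inter> U)" if "F_stable D F T" for T
    using fin[OF that] by (simp add: Int_def)
  have SU: "F_stable D F (S \<inter> U)" by (rule F_stable_subset[OF SM(1)]) simp
  show "\<exists>m. is_maximum {card S | S. F_stable D F S \<and> S \<subseteq> U} m \<and>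
      is_minimum {total_F_value F M | M. dicircuit_system D M \<and> covers_set D M U} m"
    unfolding covers_set_iff_covers_weight[OF assms(5)]
  proof (intro exI conjI)
    have "card T \<le> total_F_value F M" if "F_stable D F T" "T \<subseteq> U" for T
      using weight_F_stable_le_cover[OF that(1) SM(2,3)] weight[OF that(1)] that(2)
      by (simp add: Int_absorb2)
    moreover have "card (S \<inter> U) = total_F_value F M"
      using weight[OF SM(1)] SM(4) by simp
    ultimately show "is_maximum {card S | S. F_stable D F S \<and> S \<subseteq> U} (total_F_value F M)"
      unfolding is_maximum_def using SU by force
    show "is_minimum {total_F_value F M | M. dicircuit_system D M \<and> covers_weight D M ?w}
        (total_F_value F M)"
      unfolding is_minimum_def using SM weight_F_stable_le_cover[OF SM(1)] by force
  qed
qed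

end
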